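(* Let $n$ be a nonnegative integer and let $\alpha,\beta\in\mathbb{C}$ with $\beta$ not a negative integer. Then the following identity of polynomials in $x$ holds: $$R_n^{(\alpha,\beta)}(x)=\sum_{j=0}^{n}\frac{(-1)^n(-1)^j(\beta+1)_n\,(n+\alpha+\beta+1)_j}{(n-j)!\,2^{j}\,j!\,(\beta+1)_{j}}\;{}_{4}F_{2}\!\left(\begin{array}{c}\frac{j-n}{2},\ \frac{j+1-n}{2},\ \frac{j+n+\alpha+\beta+1}{2},\ \frac{j+n+\alpha+\beta+2}{2}\\ \frac{j+\beta+1}{2},\ \frac{j+\beta+2}{2}\end{array}\Bigg|\,1\right)H_{j}(x).$$
   Context: $(a)_0=1$ and $(a)_k=a(a+1)\cdots(a+k-1)$ denote the Pochhammer symbol. The generalized hypergeometric function is $${}_pF_q\!\left(\begin{array}{c}a_1,\dots,a_p\\ b_1,\dots,b_q\end{array}\Bigg|\,z\right)=\sum_{t=0}^{\infty}\frac{(a_1)_t\cdots(a_p)_t}{(b_1)_t\cdots(b_q)_t}\frac{z^t}{t!},$$ where no lower parameter $b_i$ is a nonpositive integer. All the series in the claim terminate, because one of the upper parameters $\frac{j-n}{2},\frac{j+1-n}{2}$ is a nonpositive integer. The shifted Jacobi polynomials are $$R_n^{(\alpha,\beta)}(x)=\frac{(-1)^n(\beta+1)_n}{n!}\sum_{s=0}^n\frac{(-n)_s\,(n+\alpha+\beta+1)_s}{(\beta+1)_s}\frac{x^s}{s!}.$$ The (physicists') Hermite polynomials are $$H_N(x)=N!\sum_{k=0}^{\lfloor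 N/2\rfloor}\frac{(-1)^k}{k!\,(N-2k)!}(2x)^{N-2k}.$$ *)

theory Defs
  imports "HOL-Analysis.Analysis" "HOL-Computational_Algebra.Computational_Algebra"
begin

text \<open>
  The library's \<^const>\<open>fps_hypergeo\<close> is the formal series (its third argument rescales
  the variable, hence the 1 below). As usual in HOL the function is total; it is the generalized
  hypergeometric function only where no lower parameter is a nonpositive integer and the series
  converges (in particular where it terminates).
\<close>

definition hypergeometric :: "complex list \<Rightarrow> complex list \<Rightarrow> complex \<Rightarrow> complex" where
  "hypergeometric as bs z = eval_fps (fps_hypergeo as bs 1) z"

lemma hypergeometric_eq_suminf:
  "hypergeometric as bs z =
     (\<Sum>t. (\<Prod>a\<leftarrow>as. pochhammer a t) / (\<Prod>b\<leftarrow>bs. pochhammer b t) * (z ^ t / fact t))"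
proof -
  have foldl_eq: "foldl (\<lambda>r a. r * pochhammer a t) c xs = c * (\<Prod>a\<leftarrow>xs. pochhammer a t)"
    for t and c :: complex and xs
    by (induction xs arbitrary: c) (simp_all add: mult.assoc)
  show ?thesis
    by (simp add: hypergeometric_def eval_fps_def foldl_eq)
qed

definition shifted_jacobi :: "complex \<Rightarrow> complex \<Rightarrow> nat \<Rightarrow> complex poly" where
  "shifted_jacobi \<alpha> \<beta> n =
     smult ((-1) ^ n * pochhammer (\<beta> + 1) n / fact n)
       (\<Sum>s = 0..n. monom (pochhammer (- of_nat n) s * pochhammer (of_nat n + \<alpha> + \<beta> + 1) s
                            / pochhammer (\<beta> + 1) s / fact s) s)"

text \<open>Physicists' normalisation (leading coefficient \<open>2 ^ N\<close>).\<close>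

definition hermite :: "nat \<Rightarrow> complex poly" where
  "hermite N =
     smult (fact N)
       (\<Sum>k = 0..N div 2. smult ((-1) ^ k / (fact k * fact (N - 2 * k))) ([:0, 2:] ^ (N - 2 * k)))"

end

theory Submission
  imports Defs
begin

text \<open>
  Insert the inverse Hermite expansion of \<open>x ^ s\<close> into the shifted Jacobi polynomial and
  collect the coefficient of \<open>H\<^sub>j\<close>, i.e. the terms \<open>s = j + 2 k\<close>. The identity
  \<open>(a)\<^bsub>j + 2 k\<^esub> = (a)\<^sub>j 4\<^sup>k ((a + j) / 2)\<^sub>k ((a + j + 1) / 2)\<^sub>k\<close> turns
  that coefficient into the terminating series.
\<close>

text \<open>After \<open>pochhammer a j\<close> is split off, the remaining
  \<open>pochhammer (a + of_nat j) (2 * k)\<close> falls under the duplication formula, which halves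
  the parameter.\<close>

lemma pochhammer_add_double:
  fixes a :: "'a :: field_char_0"
  shows "pochhammer a (j + 2 * k) =
    pochhammer a j * 4 ^ k * pochhammer ((of_nat j + a) / 2) k
      * pochhammer ((of_nat j + a + 1) / 2) k"
proof -
  have "(2 :: 'a) ^ (2 * k) = 4 ^ k"
    by (simp add: power_mult)
  thus ?thesis
    using pochhammer_double[of "(of_nat j + a) / 2" k]
    by (simp add: pochhammer_product' add_divide_distrib add_ac mult_ac)
qed

lemma smult_sum_right: "smult c (\<Sum>i\<in>A. f i) = (\<Sum>i\<in>A. smult c (f i))"
  by (induction A rule: infinite_finite_induct) (simp_all add: smult_add_right)

text \<open>Multiplied by \<open>fact m\<close>, the sum is the binomial expansion of
  \<open>(1 + (-1)) ^ m\<close>. It provides the cancellation in the inversion of the Hermite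
  expansion.\<close>

lemma sum_alternating_inverse_fact:
  "(\<Sum>k=0..m. (-1) ^ (m - k) / (fact k * fact (m - k))) =
     (if m = 0 then 1 else 0 :: 'a :: field_char_0)"
proof -
  have "(\<Sum>k=0..m. (-1) ^ (m - k) / (fact k * fact (m - k))) =
      (\<Sum>k\<le>m. of_nat (m choose k) * 1 ^ k * (-1) ^ (m - k)) / (fact m :: 'a)"
    unfolding sum_divide_distrib
    by (intro sum.cong) (auto simp: binomial_fact)
  also have "\<dots> = (1 + (-1)) ^ m / fact m"
    by (simp only: binomial_ring)
  finally show ?thesis
    by simp
qed

text \<open>Substituting the definition of \<open>hermite\<close> gives a double sum of powers of
  2x. Grouped by exponent, every coefficient is an alternating sum that vanishes, except the one of
  the top power.\<close>

lemma monom_eq_sum_hermite: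
  "monom 1 s =
     (\<Sum>k=0..s div 2. smult (fact s / (2 ^ s * fact k * fact (s - 2 * k))) (hermite (s - 2 * k)))"
proof -
  define Y :: "complex poly" where "Y = [:0, 2:]"
  have "(\<Sum>k=0..s div 2. smult (1 / (fact k * fact (s - 2 * k))) (hermite (s - 2 * k))) =
      (\<Sum>k=0..s div 2. \<Sum>l=0..(s - 2 * k) div 2.
         smult ((-1) ^ l / (fact k * fact l * fact (s - 2 * (k + l)))) (Y ^ (s - 2 * (k + l))))"
    by (simp add: hermite_def Y_def smult_sum_right algebra_simps)
  \<comment> \<open>The exponent depends only on m = k + l, and the bounds on k and l together say
    exactly that m is at most \<open>s div 2\<close>.\<close>
  also have "\<dots> = (\<Sum>m=0..s div 2. \<Sum>k=0..m.
         smult ((-1) ^ (m - k) / (fact k * fact (m - k) * fact (s - 2 * m))) (Y ^ (s - 2 * m)))"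
    unfolding sum.Sigma[OF finite_atLeastAtMost ballI[OF finite_atLeastAtMost]]
    by (rule sum.reindex_bij_witness[where i = "\<lambda>(m, k). (k, m - k)" and j = "\<lambda>(k, l). (k + l, k)"])
       auto
  also have "\<dots> = (\<Sum>m=0..s div 2.
         smult ((\<Sum>k=0..m. (-1) ^ (m - k) / (fact k * fact (m - k))) / fact (s - 2 * m))
           (Y ^ (s - 2 * m)))"
    by (simp add: smult_sum sum_divide_distrib)
  also have "\<dots> = (\<Sum>m=0..s div 2. if m = 0 then smult (1 / fact s) (Y ^ s) else 0)"
    by (intro sum.cong) (simp_all add: sum_alternating_inverse_fact)
  also have "\<dots> = smult (1 / fact s) (Y ^ s)"
    by simp
  also have "Y ^ s = smult (2 ^ s) (monom 1 s)"
  proof -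
    have "Y = monom 2 1"
      by (simp add: Y_def monom_altdef)
    thus ?thesis
      by (simp add: monom_power smult_monom)
  qed
  finally have "monom 1 s = smult (fact s / 2 ^ s)
      (\<Sum>k=0..s div 2. smult (1 / (fact k * fact (s - 2 * k))) (hermite (s - 2 * k)))"
    by simp
  thus ?thesis
    by (simp add: smult_sum_right mult_ac)
qed

text \<open>Up to the sign \<open>(-1) ^ j\<close>, the Pochhammer symbol is the falling factorial
  \<open>fact j * of_nat (n choose j)\<close>. This produces the sign and the
  \<open>fact (n - j)\<close> in the coefficient of \<open>hermite j\<close>.\<close>

lemma pochhammer_neg_of_nat_div_fact:
  assumes "j \<le> n"
  shows "pochhammer (- of_nat n) j / fact n = ((-1) ^ j / fact (n - j) :: 'a :: field_char_0)"
proof -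
  have "pochhammer (- of_nat n) j = ((-1) ^ j * fact j * of_nat (n choose j) :: 'a)"
    using pochhammer_minus[of "of_nat n" j] assms
    by (simp add: binomial_gbinomial gbinomial_pochhammer)
  thus ?thesis
    using assms by (simp add: binomial_fact)
qed

text \<open>By duplication the first two upper parameters together contribute
  \<open>pochhammer (- of_nat (n - j)) (2 * k) / 4 ^ k\<close>, which is zero as soon as 2k exceeds
  n - j.\<close>

lemma hypergeometric_4F2_terminating:
  assumes "j \<le> n"
  shows "hypergeometric
      [(of_nat j - of_nat n) / 2, (of_nat j + 1 - of_nat n) / 2, c, d] [e, f] 1 =
    (\<Sum>k=0..(n - j) div 2.
       pochhammer ((of_nat j - of_nat n) / 2) k * pochhammer ((of_nat j + 1 - of_nat n) / 2) k
       * pochhammer c k * pochhammer d k / (pochhammer e k * pochhammer f k * fact k))"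
proof -
  have "pochhammer ((of_nat j - of_nat n) / 2) k * pochhammer ((of_nat j + 1 - of_nat n) / 2) k
      = (0 :: complex)" if "k \<notin> {0..(n - j) div 2}" for k
  proof -
    have "pochhammer (- of_nat (n - j) :: complex) (2 * k) = 0"
      using that by (intro pochhammer_of_nat_eq_0_lemma) auto
    thus ?thesis
      using pochhammer_add_double[of "of_nat j - of_nat n :: complex" 0 k] assms
      by (simp add: of_nat_diff algebra_simps)
  qed
  thus ?thesis
    unfolding hypergeometric_eq_suminf
    by (subst suminf_finite[of "{0..(n - j) div 2}"]) (auto simp: mult_ac)
qed

theorem theorem3p4:
  fixes n :: nat and \<alpha> \<beta> :: complex
  assumes "\<And>m :: nat. m \<ge> 1 \<Longrightarrow> \<beta> \<noteq> - of_nat m"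
  shows "shifted_jacobi \<alpha> \<beta> n =
    (\<Sum>j = 0..n. smult
       ((-1) ^ n * (-1) ^ j * pochhammer (\<beta> + 1) n * pochhammer (of_nat n + \<alpha> + \<beta> + 1) j
          / (fact (n - j) * 2 ^ j * fact j * pochhammer (\<beta> + 1) j)
        * hypergeometric
            [(of_nat j - of_nat n) / 2,
             (of_nat j + 1 - of_nat n) / 2,
             (of_nat j + of_nat n + \<alpha> + \<beta> + 1) / 2,
             (of_nat j + of_nat n + \<alpha> + \<beta> + 2) / 2]
            [(of_nat j + \<beta> + 1) / 2,
             (of_nat j + \<beta> + 2) / 2]
            1)
       (hermite j))"
proof -
  define C where "C = (-1) ^ n * pochhammer (\<beta> + 1) n / fact n"
  define a where "a s = pochhammer (- of_nat n) s * pochhammer (of_nat n + \<alpha> + \<beta> + 1) s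
    / pochhammer (\<beta> + 1) s" for s
  have "shifted_jacobi \<alpha> \<beta> n = (\<Sum>s=0..n. smult (C * a s / fact s) (monom 1 s))"
    by (simp add: shifted_jacobi_def C_def a_def smult_sum_right smult_monom mult.assoc)
  also have "\<dots> = (\<Sum>s=0..n. \<Sum>k=0..s div 2.
      smult (C * a s / (2 ^ s * fact k * fact (s - 2 * k))) (hermite (s - 2 * k)))"
    by (simp add: monom_eq_sum_hermite smult_sum_right)
  \<comment> \<open>Collect by the Hermite index j = s - 2k: the pairs with s \<le> n and 2k \<le> s
    are those with j \<le> n and 2k \<le> n - j.\<close>
  also have "\<dots> = (\<Sum>j=0..n. \<Sum>k=0..(n - j) div 2.
      smult (C * a (j + 2 * k) / (2 ^ (j + 2 * k) * fact k * fact j)) (hermite j))"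
    unfolding sum.Sigma[OF finite_atLeastAtMost ballI[OF finite_atLeastAtMost]]
    by (rule sum.reindex_bij_witness
          [where i = "\<lambda>(j, k). (j + 2 * k, k)" and j = "\<lambda>(s, k). (s - 2 * k, k)"]) auto
  also have "\<dots> = (\<Sum>j=0..n. smult (\<Sum>k=0..(n - j) div 2.
      C * a (j + 2 * k) / (2 ^ (j + 2 * k) * fact k * fact j)) (hermite j))"
    by (simp add: smult_sum)
  also have "\<dots> = (\<Sum>j = 0..n. smult
       ((-1) ^ n * (-1) ^ j * pochhammer (\<beta> + 1) n * pochhammer (of_nat n + \<alpha> + \<beta> + 1) j
          / (fact (n - j) * 2 ^ j * fact j * pochhammer (\<beta> + 1) j)
        * hypergeometric
            [(of_nat j - of_nat n) / 2,
             (of_nat j + 1 - of_nat n) / 2,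
             (of_nat j + of_nat n + \<alpha> + \<beta> + 1) / 2,
             (of_nat j + of_nat n + \<alpha> + \<beta> + 2) / 2]
            [(of_nat j + \<beta> + 1) / 2,
             (of_nat j + \<beta> + 2) / 2]
            1)
       (hermite j))"
  proof (intro sum.cong refl arg_cong2[where f = smult])
    fix j assume "j \<in> {0..n}"
    hence j: "j \<le> n" by simp
    \<comment> \<open>Each of \<open>A\<close>, \<open>B\<close>, \<open>D\<close> is the pair of
      halved parameters that duplication yields from -n, n + \<alpha> + \<beta> + 1 and \<beta> + 1
      respectively.\<close>
    define A B D where "A = (\<lambda>k. pochhammer ((of_nat j - of_nat n) / 2 :: complex) k
        * pochhammer ((of_nat j + 1 - of_nat n) / 2) k)"
      and "B = (\<lambda>k. pochhammer ((of_nat j + of_nat n + \<alpha> + \<beta> + 1) / 2) k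
        * pochhammer ((of_nat j + of_nat n + \<alpha> + \<beta> + 2) / 2) k)"
      and "D = (\<lambda>k. pochhammer ((of_nat j + \<beta> + 1) / 2) k * pochhammer ((of_nat j + \<beta> + 2) / 2) k)"
    define L where "L = pochhammer (of_nat n + \<alpha> + \<beta> + 1) j"
    have A: "pochhammer (- of_nat n) (j + 2 * k) = pochhammer (- of_nat n) j * (4 ^ k * A k)" for k
      using pochhammer_add_double[of "- of_nat n :: complex" j k] by (simp add: A_def algebra_simps)
    have B: "pochhammer (of_nat n + \<alpha> + \<beta> + 1) (j + 2 * k) = L * (4 ^ k * B k)" for k
      using pochhammer_add_double[of "of_nat n + \<alpha> + \<beta> + 1" j k] by (simp add: B_def L_def algebra_simps)
    have D: "pochhammer (\<beta> + 1) (j + 2 * k) = pochhammer (\<beta> + 1) j * (4 ^ k * D k)" for k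
      using pochhammer_add_double[of "\<beta> + 1" j k] by (simp add: D_def algebra_simps)
    have C: "C * pochhammer (- of_nat n) j = (-1) ^ n * (-1) ^ j * pochhammer (\<beta> + 1) n / fact (n - j)"
      using pochhammer_neg_of_nat_div_fact[OF j, where 'a = complex]
      by (simp add: C_def field_simps)
    \<comment> \<open>The two factors \<open>4 ^ k\<close> from the numerator of \<open>a\<close>
      cancel against the one from its denominator and the one in \<open>2 ^ (j + 2 * k)\<close>;
      hence the series has argument 1.\<close>
    have "C * a (j + 2 * k) / (2 ^ (j + 2 * k) * fact k * fact j) =
        (C * pochhammer (- of_nat n) j) * L / (2 ^ j * fact j * pochhammer (\<beta> + 1) j)
        * (A k * B k / (D k * fact k))" for k
      unfolding a_def A B D power_add power_mult by (simp add: mult_ac)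
    hence "(\<Sum>k=0..(n - j) div 2. C * a (j + 2 * k) / (2 ^ (j + 2 * k) * fact k * fact j)) =
        (C * pochhammer (- of_nat n) j) * L / (2 ^ j * fact j * pochhammer (\<beta> + 1) j)
        * (\<Sum>k=0..(n - j) div 2. A k * B k / (D k * fact k))"
      by (simp add: sum_distrib_left)
    thus "(\<Sum>k=0..(n - j) div 2. C * a (j + 2 * k) / (2 ^ (j + 2 * k) * fact k * fact j)) =
       (-1) ^ n * (-1) ^ j * pochhammer (\<beta> + 1) n * pochhammer (of_nat n + \<alpha> + \<beta> + 1) j
          / (fact (n - j) * 2 ^ j * fact j * pochhammer (\<beta> + 1) j)
        * hypergeometric
            [(of_nat j - of_nat n) / 2,
             (of_nat j + 1 - of_nat n) / 2,
             (of_nat j + of_nat n + \<alpha> + \<beta> + 1) / 2,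
             (of_nat j + of_nat n + \<alpha> + \<beta> + 2) / 2]
            [(of_nat j + \<beta> + 1) / 2,
             (of_nat j + \<beta> + 2) / 2]
            1"
      unfolding C hypergeometric_4F2_terminating[OF j] A_def B_def D_def L_def
      by (simp add: mult_ac)
  qed
  finally show ?thesis .
qed

end
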